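(* Let $\lambda,\lambda_1,\lambda_2\in\mathbb{C}^*$. Then the quandle $M_\lambda$ is not isomorphic to the quandle $M_{\lambda_1,\lambda_2}$.
   Context: A quandle is a non-empty set $Q$ with a binary operation $*$ such that: (Q1) $x*x=x$ for all $x$; (Q2) for all $x,y\in Q$ there is a unique $z\in Q$ with $x=z*y$; (Q3) $(x*y)*z=(x*z)*(y*z)$ for all $x,y,z$. A quandle isomorphism is a bijection $\phi$ with $\phi(x*y)=\phi(x)*\phi(y)$. $M_\lambda$ is the conjugacy class in $\operatorname{GL}(2,\mathbb{C})$ of $\begin{pmatrix}\lambda&1\\0&\lambda\end{pmatrix}$, and $M_{\lambda_1,\lambda_2}$ is the conjugacy class in $\operatorname{GL}(2,\mathbb{C})$ of $\begin{pmatrix}\lambda_1&0\\0&\lambda_2\end{pmatrix}$; both are regarded as quandles with operation $X*Y=Y^{-1}XY$. *)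

theory Defs
  imports "HOL-Analysis.Analysis"
begin

locale quandle =
  fixes Q :: "'a set" and op :: "'a \<Rightarrow> 'a \<Rightarrow> 'a"  (infixl "\<star>" 70)
  assumes nonempty: "Q \<noteq> {}"
    and closed: "\<lbrakk>x \<in> Q; y \<in> Q\<rbrakk> \<Longrightarrow> x \<star> y \<in> Q"
    and idem: "x \<in> Q \<Longrightarrow> x \<star> x = x"
    and right_div: "\<lbrakk>x \<in> Q; y \<in> Q\<rbrakk> \<Longrightarrow> \<exists>!z. z \<in> Q \<and> x = z \<star> y"
    and self_distrib:
      "\<lbrakk>x \<in> Q; y \<in> Q; z \<in> Q\<rbrakk> \<Longrightarrow> (x \<star> y) \<star> z = (x \<star> z) \<star> (y \<star> z)"

definition quandle_iso ::
    "('a \<Rightarrow> 'b) \<Rightarrow> 'a set \<Rightarrow> ('a \<Rightarrow> 'a \<Rightarrow> 'a) \<Rightarrow> 'b set \<Rightarrow> ('b \<Rightarrow> 'b \<Rightarrow> 'b) \<Rightarrow> bool" where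
  "quandle_iso \<phi> Q op Q' op' \<longleftrightarrow>
     bij_betw \<phi> Q Q' \<and> (\<forall>x\<in>Q. \<forall>y\<in>Q. \<phi> (op x y) = op' (\<phi> x) (\<phi> y))"

definition quandle_isomorphic ::
    "'a set \<Rightarrow> ('a \<Rightarrow> 'a \<Rightarrow> 'a) \<Rightarrow> 'b set \<Rightarrow> ('b \<Rightarrow> 'b \<Rightarrow> 'b) \<Rightarrow> bool" where
  "quandle_isomorphic Q op Q' op' \<longleftrightarrow> (\<exists>\<phi>. quandle_iso \<phi> Q op Q' op')"

definition conj_op :: "complex^2^2 \<Rightarrow> complex^2^2 \<Rightarrow> complex^2^2" where
  "conj_op X Y = matrix_inv Y ** X ** Y"

definition GL2_class :: "complex^2^2 \<Rightarrow> (complex^2^2) set" where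
  "GL2_class A = {matrix_inv P ** A ** P | P. invertible P}"

definition M_jordan :: "complex \<Rightarrow> (complex^2^2) set" where
  "M_jordan l = GL2_class (vector [vector [l, 1], vector [0, l]])"

definition M_diag :: "complex \<Rightarrow> complex \<Rightarrow> (complex^2^2) set" where
  "M_diag l1 l2 = GL2_class (vector [vector [l1, 0], vector [0, l2]])"

lemma matrix_inv_cancel:
  fixes P :: "complex^2^2"
  assumes "invertible P"
  shows "matrix_inv P ** P = mat 1" "P ** matrix_inv P = mat 1"
    "A ** matrix_inv P ** P = A" "A ** P ** matrix_inv P = A"
proof -
  have "P ** matrix_inv P = mat 1 \<and> matrix_inv P ** P = mat 1"
    using someI_ex[of "\<lambda>R. P ** R = mat 1 \<and> R ** P = mat 1"] assms
    unfolding invertible_def matrix_inv_def by blast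
  then show "matrix_inv P ** P = mat 1" "P ** matrix_inv P = mat 1"
    "A ** matrix_inv P ** P = A" "A ** P ** matrix_inv P = A"
    by (simp_all add: matrix_mul_assoc[symmetric])
qed

lemma matrix_inv_unique:
  fixes P R :: "complex^2^2"
  assumes "P ** R = mat 1"
  shows "matrix_inv P = R"
proof -
  have i: "invertible P" using assms matrix_left_right_inverse invertible_def by blast
  have "matrix_inv P = matrix_inv P ** (P ** R)" by (simp add: assms)
  also have "\<dots> = R" by (simp add: matrix_mul_assoc matrix_inv_cancel[OF i])
  finally show ?thesis .
qed

lemma matrix_inv_mult:
  fixes P R :: "complex^2^2"
  assumes "invertible P" "invertible R"
  shows "matrix_inv (P ** R) = matrix_inv R ** matrix_inv P"
  by (rule matrix_inv_unique) (simp add: assms matrix_mul_assoc matrix_inv_cancel)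

lemma invertible_matrix_inv:
  fixes P :: "complex^2^2"
  assumes "invertible P"
  shows "invertible (matrix_inv P)" "matrix_inv (matrix_inv P) = P"
proof -
  show "invertible (matrix_inv P)"
    using matrix_inv_cancel(1,2)[OF assms] unfolding invertible_def by blast
  show "matrix_inv (matrix_inv P) = P"
    by (rule matrix_inv_unique) (rule matrix_inv_cancel(1)[OF assms])
qed

lemma GL2_class_invertible:
  assumes "invertible A" "X \<in> GL2_class A"
  shows "invertible X"
  using assms by (auto simp: GL2_class_def invertible_mult invertible_matrix_inv)

lemma GL2_class_conj:
  assumes "X \<in> GL2_class A" "invertible R"
  shows "matrix_inv R ** X ** R \<in> GL2_class A"
proof -
  obtain P where P: "invertible P" "X = matrix_inv P ** A ** P"
    using assms(1) by (auto simp: GL2_class_def)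
  have "matrix_inv R ** X ** R = matrix_inv (P ** R) ** A ** (P ** R)"
    by (simp add: P assms matrix_inv_mult matrix_mul_assoc)
  then show ?thesis using P(1) assms(2) invertible_mult unfolding GL2_class_def by blast
qed

lemma quandle_GL2_class:
  assumes A: "invertible A"
  shows "quandle (GL2_class A) conj_op"
proof
  show "GL2_class A \<noteq> {}"
    using A by (auto simp: GL2_class_def)
next
  fix X Y assume XY: "X \<in> GL2_class A" "Y \<in> GL2_class A"
  have Y: "invertible Y" using GL2_class_invertible A XY by blast
  show "conj_op X Y \<in> GL2_class A"
    using GL2_class_conj XY Y by (simp add: conj_op_def)
  show "\<exists>!Z. Z \<in> GL2_class A \<and> X = conj_op Z Y"
  proof (rule ex1I[of _ "Y ** X ** matrix_inv Y"])
    show "Y ** X ** matrix_inv Y \<in> GL2_class A \<and> X = conj_op (Y ** X ** matrix_inv Y) Y"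
      using GL2_class_conj[OF XY(1) invertible_matrix_inv(1)[OF Y]]
      by (simp add: conj_op_def matrix_mul_assoc matrix_inv_cancel invertible_matrix_inv Y)
  next
    fix Z assume "Z \<in> GL2_class A \<and> X = conj_op Z Y"
    then show "Z = Y ** X ** matrix_inv Y"
      by (simp add: conj_op_def matrix_mul_assoc matrix_inv_cancel Y)
  qed
next
  fix X assume "X \<in> GL2_class A"
  then have "invertible X" using GL2_class_invertible A by blast
  then show "conj_op X X = X"
    by (simp add: conj_op_def matrix_inv_cancel)
next
  fix X Y Z assume "X \<in> GL2_class A" "Y \<in> GL2_class A" "Z \<in> GL2_class A"
  then have "invertible Y" "invertible Z" using GL2_class_invertible A by blast+
  then show "conj_op (conj_op X Y) Z = conj_op (conj_op X Z) (conj_op Y Z)"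
    by (simp add: conj_op_def matrix_mul_assoc matrix_inv_cancel matrix_inv_mult
        invertible_mult invertible_matrix_inv)
qed

lemma quandle_M_jordan: "l \<noteq> 0 \<Longrightarrow> quandle (M_jordan l) conj_op"
  unfolding M_jordan_def
  by (rule quandle_GL2_class) (simp add: invertible_det_nz det_2)

lemma quandle_M_diag: "\<lbrakk>l1 \<noteq> 0; l2 \<noteq> 0\<rbrakk> \<Longrightarrow> quandle (M_diag l1 l2) conj_op"
  unfolding M_diag_def
  by (rule quandle_GL2_class) (simp add: invertible_det_nz det_2)

end

theory Submission
  imports Defs
begin

text \<open>
  In a conjugation quandle, \<open>X * Y = X\<close> holds exactly when \<open>X\<close> and \<open>Y\<close> commute, so a
  quandle isomorphism preserves and reflects commutation.  It therefore suffices to find a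
  pattern of commuting elements that occurs in one class and not in the other.

  The class of a Jordan block contains the one-parameter family of matrices with diagonal
  entries \<open>l\<close> and upper right entry \<open>c \<noteq> 0\<close>.  Any two of these commute, because each is a
  scalar matrix plus a multiple of the same nilpotent matrix; so some element commutes with
  infinitely many others (\<open>jordan_block_in_M_jordan\<close>, \<open>jordan_blocks_commute\<close>).  In the class
  of a diagonal matrix, by contrast, an element \<open>X\<close> commutes with at most one element besides
  itself: after diagonalising \<open>X\<close>, a commuting element is diagonal with the same eigenvalues, so
  it is \<open>X\<close> or \<open>X\<close> with its two eigenvalues exchanged (\<open>M_diag_centraliser_at_most_two\<close>).
  If \<open>l1 = l2\<close>, the second class is a single point and the same bound holds.
\<close>

lemma conj_op_eq_iff_commute:
  assumes "invertible Y"
  shows "conj_op X Y = X \<longleftrightarrow> X ** Y = Y ** X"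
proof
  assume "conj_op X Y = X"
  then have "Y ** (matrix_inv Y ** X ** Y) = Y ** X"
    by (simp add: conj_op_def)
  then show "X ** Y = Y ** X"
    by (simp add: matrix_mul_assoc matrix_inv_cancel[OF assms])
next
  assume "X ** Y = Y ** X"
  then have "matrix_inv Y ** (X ** Y) = matrix_inv Y ** (Y ** X)"
    by simp
  then show "conj_op X Y = X"
    by (simp add: conj_op_def matrix_mul_assoc matrix_inv_cancel[OF assms])
qed

lemma quandle_iso_commute_iff:
  assumes iso: "quandle_iso \<phi> Q conj_op Q' conj_op"
    and inv: "\<And>X. X \<in> Q \<Longrightarrow> invertible X" "\<And>X. X \<in> Q' \<Longrightarrow> invertible X"
    and XY: "X \<in> Q" "Y \<in> Q" "conj_op X Y \<in> Q"
  shows "\<phi> X ** \<phi> Y = \<phi> Y ** \<phi> X \<longleftrightarrow> X ** Y = Y ** X"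
proof -
  have bij: "bij_betw \<phi> Q Q'" and hom: "\<phi> (conj_op X Y) = conj_op (\<phi> X) (\<phi> Y)"
    using iso XY by (auto simp: quandle_iso_def)
  have "invertible (\<phi> Y)"
    using bij XY inv(2) bij_betwE by blast
  then have "\<phi> X ** \<phi> Y = \<phi> Y ** \<phi> X \<longleftrightarrow> \<phi> (conj_op X Y) = \<phi> X"
    by (simp add: hom conj_op_eq_iff_commute)
  also have "\<dots> \<longleftrightarrow> conj_op X Y = X"
    using bij_betw_imp_inj_on[OF bij] XY by (simp add: inj_on_eq_iff)
  also have "\<dots> \<longleftrightarrow> X ** Y = Y ** X"
    by (rule conj_op_eq_iff_commute[OF inv(1)[OF XY(2)]])
  finally show ?thesis .
qed

lemma matrix_2_eq_iff:
  fixes A B :: "complex^2^2"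
  shows "A = B \<longleftrightarrow> A$1$1 = B$1$1 \<and> A$1$2 = B$1$2 \<and> A$2$1 = B$2$1 \<and> A$2$2 = B$2$2"
  by (auto simp: vec_eq_iff forall_2)

lemma jordan_block_in_M_jordan:
  assumes "c \<noteq> 0"
  shows "vector [vector [l, c], vector [0, l]] \<in> M_jordan l"
proof -
  \<comment> \<open>Rescaling the second basis vector by \<open>c\<close> multiplies the upper right entry by \<open>c\<close>.\<close>
  let ?A = "vector [vector [l, 1], vector [0, l]] :: complex^2^2"
  let ?B = "vector [vector [l, c], vector [0, l]] :: complex^2^2"
  let ?P = "vector [vector [1, 0], vector [0, c]] :: complex^2^2"
  have inv: "invertible ?P"
    using assms by (simp add: invertible_det_nz det_2)
  have "?P ** ?B = ?A ** ?P"
    by (simp add: matrix_2_eq_iff matrix_matrix_mult_def sum_2)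
  then have "matrix_inv ?P ** (?P ** ?B) = matrix_inv ?P ** (?A ** ?P)"
    by simp
  then have "?B = matrix_inv ?P ** ?A ** ?P"
    by (simp add: matrix_mul_assoc matrix_inv_cancel[OF inv])
  then show ?thesis
    using inv unfolding M_jordan_def GL2_class_def by blast
qed

lemma jordan_blocks_commute:
  fixes l c d :: complex
  defines "A \<equiv> vector [vector [l, c], vector [0, l]] :: complex^2^2"
    and "B \<equiv> vector [vector [l, d], vector [0, l]] :: complex^2^2"
  shows "A ** B = B ** A"
  by (simp add: A_def B_def matrix_2_eq_iff matrix_matrix_mult_def sum_2)

text \<open>
  Write \<open>P ** Y = D ** P\<close> for \<open>D\<close> diagonal with entries \<open>l1, l2\<close>.  If \<open>l1 \<noteq> l2\<close>, commuting with
  \<open>D\<close> forces \<open>Y\<close> to be diagonal; comparing entries, each nonzero entry of \<open>P\<close> identifies a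
  diagonal entry of \<open>Y\<close> with one of \<open>D\<close>, and since \<open>det P \<noteq> 0\<close> either the diagonal or the
  antidiagonal of \<open>P\<close> has no zero.
\<close>
lemma M_diag_commute_diagonal:
  assumes Y: "Y \<in> M_diag l1 l2"
    and comm: "Y ** vector [vector [l1, 0], vector [0, l2]] =
               vector [vector [l1, 0], vector [0, l2]] ** Y"
  shows "Y = vector [vector [l1, 0], vector [0, l2]] \<or> Y = vector [vector [l2, 0], vector [0, l1]]"
proof -
  let ?D = "vector [vector [l1, 0], vector [0, l2]] :: complex^2^2"
  obtain P where P: "invertible P" and Yeq: "Y = matrix_inv P ** ?D ** P"
    using Y by (auto simp: M_diag_def GL2_class_def)
  show ?thesis
  proof (cases "l1 = l2")
    case True
    then have "?D ** P = P ** ?D"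
      by (simp add: matrix_2_eq_iff matrix_matrix_mult_def sum_2)
    then have "Y = matrix_inv P ** P ** ?D"
      by (simp add: Yeq matrix_mul_assoc[symmetric])
    then show ?thesis
      by (simp add: matrix_inv_cancel[OF P])
  next
    case False
    have "P ** Y = ?D ** P"
      by (simp add: Yeq matrix_mul_assoc matrix_inv_cancel[OF P])
    moreover have off: "Y$1$2 = 0" "Y$2$1 = 0"
      using comm False by (auto simp: matrix_2_eq_iff matrix_matrix_mult_def sum_2)
    ultimately have "P$1$1 = 0 \<or> Y$1$1 = l1" "P$1$2 = 0 \<or> Y$2$2 = l1"
        "P$2$1 = 0 \<or> Y$1$1 = l2" "P$2$2 = 0 \<or> Y$2$2 = l2"
      by (auto simp: matrix_2_eq_iff matrix_matrix_mult_def sum_2)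
    moreover have "P$1$1 * P$2$2 \<noteq> P$1$2 * P$2$1"
      using P by (simp add: invertible_det_nz det_2)
    ultimately have "Y$1$1 = l1 \<and> Y$2$2 = l2 \<or> Y$1$1 = l2 \<and> Y$2$2 = l1"
      by auto
    then show ?thesis
      using off by (auto simp: matrix_2_eq_iff)
  qed
qed

text \<open>
  Conjugation by an invertible matrix acts on the class by a bijection that preserves
  commutation, so \<open>X\<close> may be moved to the diagonal matrix itself.
\<close>
lemma M_diag_centraliser_at_most_two:
  assumes X: "X \<in> M_diag l1 l2" and Y: "Y \<in> M_diag l1 l2" and Z: "Z \<in> M_diag l1 l2"
    and XY: "Y ** X = X ** Y" and XZ: "Z ** X = X ** Z"
  shows "X = Y \<or> X = Z \<or> Y = Z"
proof -
  let ?D = "vector [vector [l1, 0], vector [0, l2]] :: complex^2^2"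
  let ?D' = "vector [vector [l2, 0], vector [0, l1]] :: complex^2^2"
  obtain P where P: "invertible P" and Xeq: "X = matrix_inv P ** ?D ** P"
    using X by (auto simp: M_diag_def GL2_class_def)
  define T where "T W = P ** W ** matrix_inv P" for W
  have T_mult: "T (V ** W) = T V ** T W" for V W
    by (simp add: T_def matrix_mul_assoc matrix_inv_cancel[OF P])
  have T_inverse: "matrix_inv P ** T W ** P = W" for W
    by (simp add: T_def matrix_mul_assoc matrix_inv_cancel[OF P])
  have T_inj: "V = W" if "T V = T W" for V W
    using T_inverse that by metis
  have TX: "T X = ?D"
    by (simp add: T_def Xeq matrix_mul_assoc matrix_inv_cancel[OF P])
  have T_cases: "T W = ?D \<or> T W = ?D'"
    if W: "W \<in> M_diag l1 l2" and comm: "W ** X = X ** W" for W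
  proof (rule M_diag_commute_diagonal)
    show "T W \<in> M_diag l1 l2"
      using GL2_class_conj[OF W[unfolded M_diag_def] invertible_matrix_inv(1)[OF P]]
      by (simp add: M_diag_def T_def invertible_matrix_inv(2)[OF P])
    show "T W ** ?D = ?D ** T W"
      using comm T_mult TX by metis
  qed
  show ?thesis
    using T_cases[OF Y XY] T_cases[OF Z XZ] TX T_inj by metis
qed

theorem theorem6p1:
  fixes l l1 l2 :: complex
  assumes "l \<noteq> 0" and "l1 \<noteq> 0" and "l2 \<noteq> 0"
  shows "\<not> quandle_isomorphic (M_jordan l) conj_op (M_diag l1 l2) conj_op"
proof
  assume "quandle_isomorphic (M_jordan l) conj_op (M_diag l1 l2) conj_op"
  then obtain \<phi> where iso: "quandle_iso \<phi> (M_jordan l) conj_op (M_diag l1 l2) conj_op"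
    by (auto simp: quandle_isomorphic_def)
  then have bij: "bij_betw \<phi> (M_jordan l) (M_diag l1 l2)"
    by (simp add: quandle_iso_def)
  have inv_jordan: "invertible X" if "X \<in> M_jordan l" for X
    using GL2_class_invertible[OF _ that[unfolded M_jordan_def]] assms
    by (simp add: invertible_det_nz det_2)
  have inv_diag: "invertible X" if "X \<in> M_diag l1 l2" for X
    using GL2_class_invertible[OF _ that[unfolded M_diag_def]] assms
    by (simp add: invertible_det_nz det_2)
  define J :: "complex \<Rightarrow> complex^2^2"
    where "J c = vector [vector [l, c], vector [0, l]]" for c
  have J_in: "J c \<in> M_jordan l" if "c \<noteq> 0" for c
    using jordan_block_in_M_jordan[OF that] by (simp add: J_def)
  have J_inj: "J c = J d \<longleftrightarrow> c = d" for c d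
    by (simp add: J_def matrix_2_eq_iff)
  have comm: "\<phi> (J c) ** \<phi> (J d) = \<phi> (J d) ** \<phi> (J c)" if "c \<noteq> 0" "d \<noteq> 0" for c d
  proof -
    have "conj_op (J c) (J d) \<in> M_jordan l"
      using quandle.closed[OF quandle_M_jordan[OF assms(1)]] J_in that by blast
    then show ?thesis
      using quandle_iso_commute_iff[OF iso inv_jordan inv_diag J_in[OF that(1)] J_in[OF that(2)]]
      by (simp add: J_def jordan_blocks_commute)
  qed
  have in_diag: "\<phi> (J c) \<in> M_diag l1 l2" if "c \<noteq> 0" for c
    using bij J_in[OF that] bij_betwE by blast
  have "\<phi> (J 1) = \<phi> (J 2) \<or> \<phi> (J 1) = \<phi> (J 3) \<or> \<phi> (J 2) = \<phi> (J 3)"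
    by (rule M_diag_centraliser_at_most_two[of _ l1 l2]) (simp_all add: in_diag comm)
  then have "J 1 = J 2 \<or> J 1 = J 3 \<or> J 2 = J 3"
    using bij_betw_imp_inj_on[OF bij] J_in by (simp add: inj_on_eq_iff)
  then show False
    by (simp add: J_inj)
qed

end
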